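(* For all integers $m,n$ with $2\le m\le n$, $\operatorname{rb}([m]\times[n],\, x_1+x_2=x_3)=m+n+1$.
   Context: $[m]\times[n]=\{(i,j)\in\mathbb{Z}^2: 1\le i\le m,\ 1\le j\le n\}$, with componentwise addition. An $r$-coloring of a set $S$ is a function $c:S\to\{1,\dots,r\}$; it is exact if it is surjective. A solution to $x_1+x_2=x_3$ in $[m]\times[n]$ is a triple $\alpha,\beta,\gamma\in[m]\times[n]$ with $\alpha+\beta=\gamma$; it is rainbow (with respect to $c$) if $\alpha,\beta,\gamma$ receive pairwise distinct colors (so solutions with repeated elements are never rainbow). The rainbow number $\operatorname{rb}([m]\times[n],x_1+x_2=x_3)$ is the smallest $r$ such that every exact $r$-coloring of $[m]\times[n]$ contains a rainbow solution to $x_1+x_2=x_3$. *)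

theory Defs
  imports Main "HOL-Library.Product_Plus"
begin

definition grid :: "int \<Rightarrow> int \<Rightarrow> (int \<times> int) set" where
  "grid m n = {(i, j). 1 \<le> i \<and> i \<le> m \<and> 1 \<le> j \<and> j \<le> n}"

(* Colorings are total functions; only their values on S matter. *)
definition coloring :: "nat \<Rightarrow> 'a set \<Rightarrow> ('a \<Rightarrow> nat) \<Rightarrow> bool" where
  "coloring r S c \<longleftrightarrow> (\<forall>x\<in>S. c x \<in> {1..r})"

definition exact_coloring :: "nat \<Rightarrow> 'a set \<Rightarrow> ('a \<Rightarrow> nat) \<Rightarrow> bool" where
  "exact_coloring r S c \<longleftrightarrow> coloring r S c \<and> (\<forall>k\<in>{1..r}. \<exists>x\<in>S. c x = k)"

definition solution :: "'a::plus set \<Rightarrow> 'a \<Rightarrow> 'a \<Rightarrow> 'a \<Rightarrow> bool" where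
  "solution S \<alpha> \<beta> \<gamma> \<longleftrightarrow> \<alpha> \<in> S \<and> \<beta> \<in> S \<and> \<gamma> \<in> S \<and> \<alpha> + \<beta> = \<gamma>"

definition rainbow :: "('a \<Rightarrow> nat) \<Rightarrow> 'a \<Rightarrow> 'a \<Rightarrow> 'a \<Rightarrow> bool" where
  "rainbow c \<alpha> \<beta> \<gamma> \<longleftrightarrow> c \<alpha> \<noteq> c \<beta> \<and> c \<alpha> \<noteq> c \<gamma> \<and> c \<beta> \<noteq> c \<gamma>"

(* The number of colors is required to be positive: a nonempty set has no exact
   0-coloring, so r = 0 would satisfy the condition vacuously. For r > card S the
   condition holds vacuously too, as usual, so for finite S the minimum exists. *)
definition rainbow_number :: "'a::plus set \<Rightarrow> nat" where
  "rainbow_number S = (LEAST r. 1 \<le> r \<and>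
     (\<forall>c. exact_coloring r S c \<longrightarrow>
       (\<exists>\<alpha> \<beta> \<gamma>. solution S \<alpha> \<beta> \<gamma> \<and> rainbow c \<alpha> \<beta> \<gamma>)))"

end

theory Submission
  imports Defs
begin

text \<open>Upper bound: on a diagonal \<open>i - j = k \<noteq> 0\<close> of a rainbow-free colouring at most one
  colour is new, i.e. absent from the main diagonal, since the difference of two cells of
  that diagonal lies on the main one. With \<open>t\<close> colours on the main diagonal this gives at most
  \<open>t + (m + n - 2)\<close> colours, which settles \<open>t \<le> 2\<close>. If \<open>t = w + 3\<close> and there were more than
  \<open>m + n\<close> colours, at most \<open>w\<close> diagonals would lack a new colour of their own. The lowest
  new cells of the other diagonals then form, away from the centre, an almost unbroken
  staircase from the top left to the bottom right corner. It passes far from the origin,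
  because the last new colour on the main diagonal appears at some \<open>E \<ge> 2^(w + 1) * d\<close>, where
  \<open>d\<close> is the position of the first colour change. Hence the staircase contains a horizontal
  and a vertical unit step beyond \<open>(d, d)\<close>; subtracting cells from the two ends of these
  steps forces \<open>(d - 1, d - 1)\<close>, \<open>(d, d - 1)\<close> and \<open>(d, d)\<close> to share a colour, contradicting the
  choice of \<open>d\<close>.\<close>

section \<open>First occurrences of colours on an integer interval\<close>

lemma doubling_set_Max:
  fixes S :: "int set"
  assumes "finite S" "S \<noteq> {}" "\<And>a. a \<in> S \<Longrightarrow> d \<le> a"
    and "\<And>a b. a \<in> S \<Longrightarrow> b \<in> S \<Longrightarrow> a < b \<Longrightarrow> 2 * a \<le> b"
  shows "2 ^ (card S - 1) * d \<le> Max S"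
  using assms
proof (induction S rule: finite_linorder_max_induct)
  case empty
  then show ?case by simp
next
  case (insert b A)
  show ?case
  proof (cases "A = {}")
    case True
    then show ?thesis using insert by simp
  next
    case False
    have IH: "2 ^ (card A - 1) * d \<le> Max A"
      using insert.IH False insert.prems by simp
    have "Max A \<in> A" using False insert by simp
    then have "2 * Max A \<le> b" using insert by auto
    moreover have "Max (insert b A) = b"
      using insert.hyps by (intro Max_eqI) auto
    moreover have "card (insert b A) - 1 = Suc (card A - 1)"
      using insert.hyps False by (auto simp: card_gt_0_iff)
    ultimately show ?thesis using IH by simp
  qed
qed

text \<open>Let \<open>a < b\<close> be first occurrences of their colours. If
  \<open>b < 2 * a\<close>, then \<open>b - a\<close> precedes both, so \<open>a\<close>,
  \<open>b - a\<close> and \<open>b\<close> have three distinct colours. Hence first occurrences at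
  least double; \<open>d\<close> is the second of them and \<open>E\<close> the last.\<close>

lemma schur_first_occurrence:
  fixes f :: "int \<Rightarrow> 'c" and L :: int
  assumes free: "\<And>a b. 1 \<le> a \<Longrightarrow> 1 \<le> b \<Longrightarrow> a + b \<le> L \<Longrightarrow>
      f a = f b \<or> f a = f (a + b) \<or> f b = f (a + b)"
    and t: "2 \<le> card (f ` {1..L})"
  shows "\<exists>d E. 2 \<le> d \<and> f (d - 1) \<noteq> f d \<and> E \<le> L \<and>
    (\<forall>b. 1 \<le> b \<longrightarrow> b < E \<longrightarrow> f b \<noteq> f E) \<and> 2 ^ (card (f ` {1..L}) - 2) * d \<le> E"
proof -
  define S where "S = {e \<in> {1..L}. \<forall>b\<in>{1..<e}. f b \<noteq> f e}"
  have finS: "finite S" by (rule finite_subset[of _ "{1..L}"]) (auto simp: S_def)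
  have "f i \<in> f ` S" if "i \<in> {1..L}" for i
    using that
  proof (induction "nat i" arbitrary: i rule: less_induct)
    case less
    show ?case
    proof (cases "i \<in> S")
      case False
      then obtain b where b: "b \<in> {1..<i}" "f b = f i"
        using less.prems unfolding S_def by auto
      then have "f b \<in> f ` S"
        using less.prems by (intro less.hyps) auto
      then show ?thesis using b by simp
    qed auto
  qed
  then have "f ` {1..L} \<subseteq> f ` S" by blast
  moreover have "S \<subseteq> {1..L}" unfolding S_def by auto
  ultimately have img: "f ` S = f ` {1..L}" by blast
  have "inj_on f S"
  proof (rule inj_onI)
    fix a b assume "a \<in> S" "b \<in> S" "f a = f b"
    then show "a = b" unfolding S_def by (cases a b rule: linorder_cases) auto
  qed
  then have cardS: "card S = card (f ` {1..L})"
    using img by (metis card_image)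
  have L: "1 \<le> L" using t by (cases "1 \<le> L") auto
  have one: "1 \<in> S" using L unfolding S_def by auto
  have dbl: "2 * a \<le> b" if "a \<in> S" "b \<in> S" "a < b" for a b
  proof (rule ccontr)
    assume "\<not> 2 * a \<le> b"
    then have "b - a < a" by simp
    then have "f (b - a) \<noteq> f a" using that unfolding S_def by auto
    moreover have "f (b - a) \<noteq> f b" "f a \<noteq> f b" using that unfolding S_def by auto
    moreover have "f a = f (b - a) \<or> f a = f (a + (b - a)) \<or> f (b - a) = f (a + (b - a))"
      using that unfolding S_def by (intro free) auto
    ultimately show False by auto
  qed
  \<comment> \<open>Dropping the first occurrence \<open>1\<close> makes \<open>d\<close> the
    minimum; from \<open>d\<close> to the maximum of the rest there are two doublings fewer than
    colours, hence the exponent.\<close>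
  let ?T = "S - {1}"
  have cT: "card ?T = card S - 1" using one finS by simp
  have neT: "?T \<noteq> {}" using cT t cardS by force
  define d where "d = Min ?T"
  have dT: "d \<in> ?T" unfolding d_def using finS neT by (intro Min_in) auto
  have dmin: "d \<le> a" if "a \<in> ?T" for a unfolding d_def using finS that by (intro Min_le) auto
  have d2: "2 \<le> d" using dT unfolding S_def by auto
  have max: "2 ^ (card ?T - 1) * d \<le> Max ?T"
    using finS neT dmin dbl by (intro doubling_set_Max) auto
  have ET: "Max ?T \<in> ?T" using finS neT by (intro Max_in) auto
  have "2 ^ (card (f ` {1..L}) - 2) * d \<le> Max ?T"
    using max unfolding cT cardS by (simp add: diff_diff_left eval_nat_numeral)
  moreover have "f (d - 1) \<noteq> f d" using dT d2 unfolding S_def by auto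
  moreover have "Max ?T \<le> L" "\<forall>b. 1 \<le> b \<longrightarrow> b < Max ?T \<longrightarrow> f b \<noteq> f (Max ?T)"
    using ET unfolding S_def by auto
  ultimately show ?thesis using d2 by blast
qed

section \<open>Unit steps in a staircase with few gaps\<close>

text \<open>Without such a step, adjacent indices lose no height, and a jump with
  \<open>b - a > 1\<close> loses at most \<open>b - a \<le> 2 * (b - a - 1)\<close>. So
  \<open>p\<close> drops by at most two per missing index, which contradicts \<open>upper\<close> at
  the last index of \<open>A\<close>.\<close>

lemma staircase_unit_step:
  fixes A :: "int set" and p :: "int \<Rightarrow> int" and k N w d :: int
  assumes A: "A \<subseteq> {k..N - 1}" and k: "k \<in> A"
    and missing: "int (card ({k..N - 1} - A)) \<le> w"
    and upper: "\<And>a. a \<in> A \<Longrightarrow> p a \<le> N - a"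
    and step: "\<And>a b. a \<in> A \<Longrightarrow> b \<in> A \<Longrightarrow> a < b \<Longrightarrow> {a<..<b} \<inter> A = {} \<Longrightarrow> p a - (b - a) \<le> p b"
    and start: "d < p k - 2 * w" and d: "1 \<le> d"
  obtains a where "a \<in> A" "a + 1 \<in> A" "p (a + 1) = p a - 1" "d \<le> p (a + 1)"
proof -
  have finA: "finite A" using A by (rule finite_subset) simp
  have False if no: "\<And>a. a \<in> A \<Longrightarrow> a + 1 \<in> A \<Longrightarrow> p (a + 1) = p a - 1 \<Longrightarrow> p (a + 1) < d"
  proof -
    define g where "g b = int (card ({k..<b} - A))" for b
    have gw: "g b \<le> w" if "b \<in> A" for b
    proof -
      have "card ({k..<b} - A) \<le> card ({k..N - 1} - A)"
        using that A by (intro card_mono) auto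
      then show ?thesis using missing unfolding g_def by simp
    qed
    have low: "p k - 2 * g b \<le> p b" if "b \<in> A" for b
      using that
    proof (induction "nat (b - k)" arbitrary: b rule: less_induct)
      case less
      show ?case
      proof (cases "b = k")
        case True
        then show ?thesis by (simp add: g_def)
      next
        case False
        define a where "a = Max (A \<inter> {..<b})"
        have "k \<in> A \<inter> {..<b}" using k less.prems False A by force
        then have aA: "a \<in> A \<inter> {..<b}"
          unfolding a_def using finA by (intro Max_in) auto
        have gap: "{a<..<b} \<inter> A = {}"
        proof -
          have "y \<le> a" if "y \<in> A" "y < b" for y
            unfolding a_def using that finA by (intro Max_ge) auto
          then show ?thesis by force
        qed
        have ak: "k \<le> a" using aA A by auto
        have pa: "p k - 2 * g a \<le> p a"
          using aA ak by (intro less.hyps) auto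
        have pb: "p a - (b - a) \<le> p b" using aA less.prems gap by (intro step) auto
        have "{k..<b} - A = ({k..<a} - A) \<union> {a<..<b}" using gap aA ak by force
        moreover have "card (({k..<a} - A) \<union> {a<..<b}) = card ({k..<a} - A) + card {a<..<b}"
          by (intro card_Un_disjoint) auto
        ultimately have gb: "g b = g a + (b - a - 1)"
          unfolding g_def using aA by simp
        show ?thesis
        proof (cases "b = a + 1")
          case True
          \<comment> \<open>A drop by exactly one would have to land below \<open>d\<close>, but
            \<open>p a - 1 \<ge> p k - 2 * w - 1 \<ge> d\<close>.\<close>
          have "p b \<noteq> p a - 1"
          proof
            assume *: "p b = p a - 1"
            then have "p b < d" using no[of a] aA less.prems True by auto
            moreover have "g a \<le> w" using gw aA by auto
            ultimately show False using * pa start by linarith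
          qed
          then show ?thesis using pa pb gb True by linarith
        next
          case False
          then show ?thesis using pa pb gb aA by auto
        qed
      qed
    qed
    \<comment> \<open>All indices after \<open>B\<close> are missing, so
      \<open>p B \<le> N - B \<le> w - g B + 1\<close>, while
      \<open>p B \<ge> p k - 2 * g B > d + 2 * w - 2 * g B\<close>.\<close>
    define B where "B = Max A"
    have B: "B \<in> A" unfolding B_def using finA k by (intro Max_in) auto
    have "a \<le> B" if "a \<in> A" for a unfolding B_def using that finA by simp
    then have "A \<inter> {B<..N - 1} = {}" by force
    moreover have "{k..N - 1} = {k..<B} \<union> {B} \<union> {B<..N - 1}" using B A by auto
    ultimately have "{k..N - 1} - A = ({k..<B} - A) \<union> {B<..N - 1}"
      using B by blast
    moreover have "card (({k..<B} - A) \<union> {B<..N - 1}) = card ({k..<B} - A) + card {B<..N - 1}"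
      by (intro card_Un_disjoint) auto
    ultimately have "g B + (N - 1 - B) \<le> w"
      using missing B A unfolding g_def by auto
    moreover have "B \<le> N - 1" using B A by auto
    ultimately show False using low[OF B] upper[OF B] start d by linarith
  qed
  then show thesis using that by (metis not_le)
qed

section \<open>New colours off the main diagonal\<close>

locale rainbow_free_grid =
  fixes m n :: int and c :: "int \<times> int \<Rightarrow> nat"
  assumes free: "\<lbrakk>\<alpha> \<in> grid m n; \<beta> \<in> grid m n; \<alpha> + \<beta> \<in> grid m n\<rbrakk> \<Longrightarrow>
    c \<alpha> = c \<beta> \<or> c \<alpha> = c (\<alpha> + \<beta>) \<or> c \<beta> = c (\<alpha> + \<beta>)"
begin

definition old :: "nat set" where
  "old = (\<lambda>i. c (i, i)) ` {1..min m n}"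

lemma oldI: "1 \<le> i \<Longrightarrow> i \<le> m \<Longrightarrow> i \<le> n \<Longrightarrow> c (i, i) \<in> old"
  unfolding old_def by auto

lemma free_diff:
  assumes "(i, j) \<in> grid m n" "(i', j') \<in> grid m n" "i < i'" "j < j'"
  shows "c (i, j) = c (i' - i, j' - j) \<or> c (i, j) = c (i', j') \<or> c (i' - i, j' - j) = c (i', j')"
  using free[of "(i, j)" "(i' - i, j' - j)"] assms by (auto simp: grid_def)

lemma new_unique_aux:
  assumes "(i, j) \<in> grid m n" "(i', j') \<in> grid m n" "i - j = i' - j'" "i < i'"
    and "c (i, j) \<notin> old" "c (i', j') \<notin> old"
  shows "c (i, j) = c (i', j')"
proof -
  have "c (i' - i, j' - j) \<in> old"
  proof -
    have "j' - j = i' - i" using assms(3) by simp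
    then show ?thesis using assms(1,2,4) by (auto simp: grid_def intro!: oldI)
  qed
  then show ?thesis using free_diff[OF assms(1,2)] assms by fastforce
qed

lemma new_unique:
  assumes "(i, j) \<in> grid m n" "(i', j') \<in> grid m n" "i - j = i' - j'"
    and "c (i, j) \<notin> old" "c (i', j') \<notin> old"
  shows "c (i, j) = c (i', j')"
  using new_unique_aux[of i j i' j'] new_unique_aux[of i' j' i j] assms
  by (cases i i' rule: linorder_cases) auto

end

text \<open>The cell \<open>x k\<close> is the lowest cell of the diagonal \<open>i - j = k\<close> with a colour
  that is absent from the main diagonal. Each such colour is represented at most once, and
  on a diagonal as close as possible to the main one.\<close>

locale diagonal_representatives = rainbow_free_grid +
  fixes K :: "int set" and x :: "int \<Rightarrow> int \<times> int"
  assumes K0: "0 \<notin> K"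
    and x_grid: "k \<in> K \<Longrightarrow> x k \<in> grid m n"
    and x_diag: "k \<in> K \<Longrightarrow> fst (x k) - snd (x k) = k"
    and x_new: "k \<in> K \<Longrightarrow> c (x k) \<notin> old"
    and x_low: "k \<in> K \<Longrightarrow> (i, j) \<in> grid m n \<Longrightarrow> i - j = k \<Longrightarrow> c (i, j) \<notin> old \<Longrightarrow> fst (x k) \<le> i"
    and x_inj: "k \<in> K \<Longrightarrow> l \<in> K \<Longrightarrow> c (x k) = c (x l) \<Longrightarrow> k = l"
    and x_near: "k \<in> K \<Longrightarrow> (i, j) \<in> grid m n \<Longrightarrow> c (i, j) = c (x k) \<Longrightarrow> \<bar>k\<bar> \<le> \<bar>i - j\<bar>"
begin

lemma x_coords:
  assumes "k \<in> K"
  obtains i j where "x k = (i, j)" "(i, j) \<in> grid m n" "i - j = k"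
  using x_grid[OF assms] x_diag[OF assms] by (cases "x k") auto

lemma new_on_diag:
  assumes "k \<in> K" "(i, j) \<in> grid m n" "i - j = k" "c (i, j) \<notin> old"
  shows "c (i, j) = c (x k)"
proof -
  obtain i' j' where x: "x k = (i', j')" "(i', j') \<in> grid m n" "i' - j' = k"
    using x_coords[OF assms(1)] .
  then show ?thesis
    using new_unique[of i j i' j'] x_new[OF assms(1)] assms by auto
qed

lemma other_new_on_diag:
  assumes "k \<in> K" "l \<in> K" "(i, j) \<in> grid m n" "i - j = k" "c (i, j) = c (x l)"
  shows "l = k"
  using new_on_diag[of k i j] x_new[of l] x_inj assms by auto

section \<open>Relative position of the representatives\<close>

text \<open>Otherwise subtracting \<open>x k\<close> from \<open>(E, E)\<close> gives a cell on
  diagonal \<open>- k\<close> that must share the colour of \<open>(E, E)\<close>. Comparing it with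
  \<open>x (- k)\<close> leaves only the case that \<open>x (- k)\<close> exceeds \<open>x k\<close>
  in both coordinates; their difference then lies on diagonal \<open>- 2 * k\<close>, where neither
  colour can occur.\<close>

lemma central:
  assumes K: "k \<in> K" "- k \<in> K" "- 2 * k \<in> K" and k: "0 < k"
    and E: "E \<le> m" "E \<le> n" "\<And>b. 1 \<le> b \<Longrightarrow> b < E \<Longrightarrow> c (b, b) \<noteq> c (E, E)"
  shows "E \<le> fst (x k)"
proof (rule ccontr)
  assume "\<not> E \<le> fst (x k)"
  obtain i p where x: "x k = (i, p)" "(i, p) \<in> grid m n" "i - p = k"
    using x_coords[OF K(1)] .
  obtain q j where y: "x (- k) = (q, j)" "(q, j) \<in> grid m n" "q - j = - k"
    using x_coords[OF K(2)] .
  have i: "i = p + k" and j: "j = q + k" using x y by auto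
  have iE: "p + k < E" using \<open>\<not> E \<le> fst (x k)\<close> x i by simp
  define q' where "q' = E - p - k"
  have bounds: "1 \<le> p" "p + k \<le> m" "p \<le> n" "1 \<le> q" "q \<le> m" "q + k \<le> n"
    using x(2) y(2) i j by (auto simp: grid_def)
  have Eold: "c (E, E) \<in> old" using E iE bounds k by (intro oldI) auto
  \<comment> \<open>\<open>(q', q' + k)\<close> is the reflection of \<open>x k\<close> in \<open>(E, E)\<close>.\<close>
  have zg: "(q', q' + k) \<in> grid m n"
    unfolding q'_def grid_def using E iE bounds k by auto
  have "c (q', q' + k) \<noteq> c (x k)"
    using other_new_on_diag[OF K(2,1) zg] k by auto
  moreover have "c (i, p) = c (E - i, E - p) \<or> c (i, p) = c (E, E) \<or> c (E - i, E - p) = c (E, E)"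
    using x(2) E iE i k bounds by (intro free_diff) (auto simp: grid_def)
  moreover have zeq: "(E - i, E - p) = (q', q' + k)" unfolding q'_def i by simp
  ultimately have cz: "c (q', q' + k) = c (E, E)"
    using Eold x_new[OF K(1)] x(1) zeq by auto
  consider "q < q'" | "q = q'" | "q' < q" by linarith
  then show False
  proof cases
    case 1
    have "c (q, j) = c (q' - q, q' + k - j) \<or> c (q, j) = c (q', q' + k)
        \<or> c (q' - q, q' + k - j) = c (q', q' + k)"
      using 1 j by (intro free_diff[OF y(2) zg]) auto
    moreover have "q' < E" unfolding q'_def using bounds k by simp
    then have "c (q' - q, q' - q) \<noteq> c (E, E)" using 1 bounds by (intro E(3)) auto
    moreover have "c (q' - q, q' - q) \<in> old"
      using 1 bounds E \<open>q' < E\<close> by (intro oldI) auto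
    ultimately show False using Eold x_new[OF K(2)] y(1) cz j by auto
  next
    case 2
    then show False using Eold x_new[OF K(2)] y(1) cz j by auto
  next
    case 3
    have "c (q', q' + k) = c (q - q', j - (q' + k)) \<or> c (q', q' + k) = c (q, j)
        \<or> c (q - q', j - (q' + k)) = c (q, j)"
      using 3 j by (intro free_diff[OF zg y(2)]) auto
    moreover have "1 \<le> q'" using iE unfolding q'_def by simp
    then have "c (q - q', q - q') \<in> old"
      using 3 bounds k by (intro oldI) auto
    ultimately have "c (q - q', q - q') = c (E, E)"
      using Eold x_new[OF K(2)] y(1) cz j by auto
    \<comment> \<open>The colour of \<open>(E, E)\<close> does not occur earlier on the main
      diagonal, so \<open>q \<ge> E + q' > E > fst (x k)\<close>.\<close>
    then have "E \<le> q - q'" using E(3)[of "q - q'"] 3 by fastforce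
    then have big: "p + k < q" using \<open>1 \<le> q'\<close> iE by simp
    have vg: "(q - i, j - p) \<in> grid m n"
      using big bounds k i j by (auto simp: grid_def)
    have "c (i, p) = c (q - i, j - p) \<or> c (i, p) = c (q, j) \<or> c (q - i, j - p) = c (q, j)"
      using big i j k by (intro free_diff[OF x(2) y(2)]) auto
    moreover have "c (q - i, j - p) \<noteq> c (i, p)" "c (q - i, j - p) \<noteq> c (q, j)"
      using other_new_on_diag[OF K(3,1) vg] other_new_on_diag[OF K(3,2) vg] x y i j k by auto
    moreover have "c (i, p) \<noteq> c (q, j)" using x_inj[OF K(1,2)] x y k by auto
    ultimately show False by auto
  qed
qed

text \<open>The difference \<open>x a - x b\<close> lies on diagonal \<open>a - b\<close>, closer to
  the main one than \<open>b\<close>, so \<open>x_near\<close> excludes the colour of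
  \<open>x b\<close> and the difference has that of \<open>x a\<close>. Now \<open>x_near\<close>
  for \<open>a\<close> gives the inequality, and a diagonal in \<open>K\<close> could not carry the
  new colour of another one.\<close>

lemma outward_descent:
  assumes "a \<in> K" "b \<in> K" "0 < a" "a < b" "fst (x b) < fst (x a)" "snd (x b) < snd (x a)"
  shows "a \<le> b - a \<and> a - b \<notin> K"
proof -
  obtain i j where x: "x a = (i, j)" "(i, j) \<in> grid m n" "i - j = a"
    using x_coords[OF assms(1)] .
  obtain i' j' where y: "x b = (i', j')" "(i', j') \<in> grid m n" "i' - j' = b"
    using x_coords[OF assms(2)] .
  have lt: "i' < i" "j' < j" using assms x y by auto
  have vg: "(i - i', j - j') \<in> grid m n"
    using x(2) y(2) lt by (auto simp: grid_def)
  have vd: "(i - i') - (j - j') = a - b" using x y by simp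
  have "c (i', j') \<noteq> c (i, j)" using x_inj[OF assms(1,2)] assms x y by auto
  moreover have "c (i - i', j - j') \<noteq> c (i', j')"
    using x_near[OF assms(2) vg] y(1) vd assms by auto
  ultimately have v: "c (i - i', j - j') = c (x a)"
    using free_diff[OF y(2) x(2) lt] x(1) by auto
  have "a \<le> b - a" using x_near[OF assms(1) vg v] vd assms by auto
  moreover have "a - b \<notin> K"
    using other_new_on_diag[OF _ assms(1) vg vd v] assms by auto
  ultimately show ?thesis by simp
qed

text \<open>The staircase lemma is applied to the second coordinates on diagonals from
  \<open>k\<close> on. Its step condition says that \<open>fst (x a)\<close> never decreases; a
  decrease would, by \<open>outward_descent\<close>, make \<open>b - a \<ge> k > w\<close> diagonals
  missing.\<close>

lemma descending_pair:
  fixes w d E k :: int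
  assumes missing: "int (card ({1 - n..m - 1} - {0} - K)) \<le> w"
    and k: "w < k" "k \<le> 2 * w + 1" "k \<in> K" "- k \<in> K" "- 2 * k \<in> K"
    and E: "E \<le> m" "E \<le> n" "\<And>b. 1 \<le> b \<Longrightarrow> b < E \<Longrightarrow> c (b, b) \<noteq> c (E, E)"
      "d + 4 * w + 1 < E" and d: "1 \<le> d"
  shows "\<exists>a\<ge>k. a \<in> K \<and> a + 1 \<in> K \<and> fst (x (a + 1)) = fst (x a) \<and>
    snd (x (a + 1)) = snd (x a) - 1 \<and> d \<le> snd (x (a + 1))"
proof -
  let ?M = "{1 - n..m - 1} - {0} - K"
  have w0: "0 \<le> w" using missing by linarith
  define A where "A = K \<inter> {k..}"
  have n1: "1 \<le> n" and km: "k \<le> m - 1"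
    using x_grid[OF k(3)] x_diag[OF k(3)] by (cases "x k"; simp add: grid_def)+
  have range: "a \<le> m - snd (x a)" "1 \<le> snd (x a)" if "a \<in> K" for a
    using x_grid[OF that] x_diag[OF that] by (cases "x a"; simp add: grid_def)+
  have "A \<subseteq> {k..m - 1}"
    using range unfolding A_def by fastforce
  moreover have "k \<in> A" unfolding A_def using k by simp
  moreover have "int (card ({k..m - 1} - A)) \<le> w"
  proof -
    have "{k..m - 1} - A \<subseteq> ?M" unfolding A_def using k w0 n1 by auto
    then have "card ({k..m - 1} - A) \<le> card ?M" by (intro card_mono) auto
    then show ?thesis using missing by linarith
  qed
  moreover have "snd (x a) \<le> m - a" if "a \<in> A" for a
    using range[of a] that unfolding A_def by simp
  moreover have "snd (x a) - (b - a) \<le> snd (x b)"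
    if a: "a \<in> A" and b: "b \<in> A" and ab: "a < b" and gap: "{a<..<b} \<inter> A = {}" for a b
  proof (rule ccontr)
    assume lt: "\<not> snd (x a) - (b - a) \<le> snd (x b)"
    have K: "a \<in> K" "b \<in> K" and ka: "k \<le> a" using a b unfolding A_def by auto
    have "fst (x b) < fst (x a)" using lt x_diag[OF K(1)] x_diag[OF K(2)] by linarith
    then have desc: "a \<le> b - a" "a - b \<notin> K"
      using outward_descent[OF K] lt ab ka k w0 by auto
    have b2: "b \<le> m - 1" using range[OF K(2)] by linarith
    \<comment> \<open>Such a descent needs the diagonal \<open>a - b\<close> to be missing, on top of those in the gap.\<close>
    have "b - a \<le> n - 1"
    proof -
      obtain i j where x: "x a = (i, j)" "(i, j) \<in> grid m n" "i - j = a"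
        using x_coords[OF K(1)] .
      then have "j \<le> n" by (auto simp: grid_def)
      then show ?thesis using lt range[OF K(2)] x by simp
    qed
    then have "insert (a - b) {a<..<b} \<subseteq> ?M"
      using desc gap b2 ab ka k w0 n1 unfolding A_def by auto
    then have "card (insert (a - b) {a<..<b}) \<le> card ?M" by (intro card_mono) auto
    moreover have "card (insert (a - b) {a<..<b}) = Suc (nat (b - a - 1))"
      using ab ka k w0 by simp
    ultimately have "b - a \<le> w" using missing ab by linarith
    then show False using desc ka k by linarith
  qed
  \<comment> \<open>\<open>snd (x k) = fst (x k) - k \<ge> E - k > d + (4 * w + 1) - (2 * w +
    1)\<close>.\<close>
  moreover have "d < snd (x k) - 2 * w"
  proof -
    have "E \<le> fst (x k)" using central[OF k(3,4,5) _ E(1-3)] k w0 by auto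
    then show ?thesis using x_diag[OF k(3)] E(4) k by linarith
  qed
  ultimately obtain a where a: "a \<in> A" "a + 1 \<in> A" "snd (x (a + 1)) = snd (x a) - 1" "d \<le> snd (x (a + 1))"
    using staircase_unit_step[of A k m w "\<lambda>a. snd (x a)" d] d by blast
  have "fst (x (a + 1)) = fst (x a)"
    using x_diag[of a] x_diag[of "a + 1"] a unfolding A_def by auto
  then show ?thesis using a unfolding A_def by auto
qed

text \<open>Reflection in the main diagonal carries results about positive diagonals over to
  negative ones. \<open>x_low\<close> survives because both coordinates order the cells of a
  diagonal alike.\<close>

lemma transposed:
  "diagonal_representatives n m (c \<circ> prod.swap) (uminus ` K) (\<lambda>k. prod.swap (x (- k)))"
proof -
  have sw: "rainbow_free_grid n m (c \<circ> prod.swap)"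
  proof
    fix \<alpha> \<beta> :: "int \<times> int"
    assume "\<alpha> \<in> grid n m" "\<beta> \<in> grid n m" "\<alpha> + \<beta> \<in> grid n m"
    then show "(c \<circ> prod.swap) \<alpha> = (c \<circ> prod.swap) \<beta> \<or> (c \<circ> prod.swap) \<alpha> = (c \<circ> prod.swap) (\<alpha> + \<beta>)
        \<or> (c \<circ> prod.swap) \<beta> = (c \<circ> prod.swap) (\<alpha> + \<beta>)"
      using free[of "prod.swap \<alpha>" "prod.swap \<beta>"] by (auto simp: grid_def split: prod.splits)
  qed
  have g: "(i, j) \<in> grid n m \<longleftrightarrow> (j, i) \<in> grid m n" for i j by (auto simp: grid_def)
  have gs: "prod.swap y \<in> grid n m \<longleftrightarrow> y \<in> grid m n" for y by (cases y) (simp add: g)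
  have o: "rainbow_free_grid.old n m (c \<circ> prod.swap) = old"
    unfolding old_def rainbow_free_grid.old_def[OF sw] by (simp add: min.commute)
  have low: "snd (x k) \<le> i" if "k \<in> K" "(j, i) \<in> grid m n" "i - j = - k" "c (j, i) \<notin> old" for k i j
    using x_low[OF that(1,2)] that x_diag[OF that(1)] by auto
  show ?thesis
    unfolding diagonal_representatives_def diagonal_representatives_axioms_def o
  proof (intro conjI allI impI)
    show "0 \<notin> uminus ` K" using K0 by auto
    fix k assume "k \<in> uminus ` K"
    then have k: "- k \<in> K" by auto
    show "prod.swap (x (- k)) \<in> grid n m" using x_grid[OF k] by (simp add: gs)
    show "fst (prod.swap (x (- k))) - snd (prod.swap (x (- k))) = k" using x_diag[OF k] by simp
    show "(c \<circ> prod.swap) (prod.swap (x (- k))) \<notin> old" using x_new[OF k] by simp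
    show "fst (prod.swap (x (- k))) \<le> i"
      if "(i, j) \<in> grid n m" "i - j = k" "(c \<circ> prod.swap) (i, j) \<notin> old" for i j
      using low[OF k, of j i] that g by simp
    show "k = l" if "l \<in> uminus ` K"
      "(c \<circ> prod.swap) (prod.swap (x (- k))) = (c \<circ> prod.swap) (prod.swap (x (- l)))" for l
      using x_inj[OF k, of "- l"] that by auto
    show "\<bar>k\<bar> \<le> \<bar>i - j\<bar>"
      if "(i, j) \<in> grid n m" "(c \<circ> prod.swap) (i, j) = (c \<circ> prod.swap) (prod.swap (x (- k)))" for i j
      using x_near[OF k, of j i] that g by simp
  qed (rule sw)
qed

section \<open>Contradiction from too few missing diagonals\<close>

lemma too_few_missing:
  fixes w :: nat
  assumes missing: "card ({1 - n..m - 1} - {0} - K) \<le> w" and old: "card old = w + 3"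
  shows False
proof -
  let ?M = "{1 - n..m - 1} - {0} - K"
  let ?L = "min m n"
  have "\<exists>d E. 2 \<le> d \<and> c (d - 1, d - 1) \<noteq> c (d, d) \<and> E \<le> ?L
      \<and> (\<forall>b. 1 \<le> b \<longrightarrow> b < E \<longrightarrow> c (b, b) \<noteq> c (E, E)) \<and> 2 ^ (w + 1) * d \<le> E"
  proof -
    have "c (a, a) = c (b, b) \<or> c (a, a) = c (a + b, a + b) \<or> c (b, b) = c (a + b, a + b)"
      if "1 \<le> a" "1 \<le> b" "a + b \<le> ?L" for a b
      using free[of "(a, a)" "(b, b)"] that by (auto simp: grid_def)
    moreover have "2 \<le> card ((\<lambda>i. c (i, i)) ` {1..?L})" using old unfolding old_def by simp
    ultimately have "\<exists>d E. 2 \<le> d \<and> c (d - 1, d - 1) \<noteq> c (d, d) \<and> E \<le> ?L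
        \<and> (\<forall>b. 1 \<le> b \<longrightarrow> b < E \<longrightarrow> c (b, b) \<noteq> c (E, E)) \<and> 2 ^ (card old - 2) * d \<le> E"
      unfolding old_def by (rule schur_first_occurrence[of ?L "\<lambda>i. c (i, i)"])
    moreover have "card old - 2 = w + 1" using old by simp
    ultimately show ?thesis by simp
  qed
  then obtain d E where d: "2 \<le> d" "c (d - 1, d - 1) \<noteq> c (d, d)"
    and E: "E \<le> m" "E \<le> n" "\<And>b. 1 \<le> b \<Longrightarrow> b < E \<Longrightarrow> c (b, b) \<noteq> c (E, E)"
    and dE: "2 ^ (w + 1) * d \<le> E" by auto
  \<comment> \<open>For \<open>d \<ge> 2\<close>, \<open>2 ^ (w + 1) * d \<ge> (2 * w + 2) * d = d +
    (2 * w + 1) * d \<ge> d + 4 * w + 2\<close>.\<close>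
  have "int w + 1 \<le> 2 ^ w" by (induction w) auto
  then have pw: "2 * int w + 2 \<le> 2 ^ (w + 1)" by simp
  have "(2 * int w + 2) * d \<le> 2 ^ (w + 1) * d" using pw d by (intro mult_right_mono) auto
  moreover have "(2 * int w + 1) * 2 \<le> (2 * int w + 1) * d" using d by (intro mult_left_mono) auto
  ultimately have big: "d + 4 * int w + 2 \<le> E" using dE by (simp add: algebra_simps)

  \<comment> \<open>The \<open>w + 1\<close> sets \<open>{k, -k, -2k, 2k}\<close> are disjoint, so the \<open>w\<close> missing diagonals cannot
    meet all of them; \<open>h\<close> recovers \<open>k\<close> from an element.\<close>
  have "\<exists>k\<in>{int w + 1..2 * int w + 1}. {k, - k, - 2 * k, 2 * k} \<subseteq> K"
  proof (rule ccontr)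
    assume no: "\<not> ?thesis"
    define h where "h v = (if \<bar>v\<bar> \<le> 2 * int w + 1 then \<bar>v\<bar> else \<bar>v\<bar> div 2)" for v :: int
    have "{int w + 1..2 * int w + 1} \<subseteq> h ` ?M"
    proof
      fix k assume kw: "k \<in> {int w + 1..2 * int w + 1}"
      then have k: "0 < k" "int w < k" "k \<le> 2 * int w + 1" by auto
      have "\<not> {k, - k, - 2 * k, 2 * k} \<subseteq> K" using no kw by blast
      then obtain v where v: "v = k \<or> v = - k \<or> v = - 2 * k \<or> v = 2 * k" "v \<notin> K" by blast
      have "2 * k \<le> m - 1" "2 * k \<le> n - 1" using k E(1,2) big d(1) by linarith+
      then have "v \<in> ?M" using v k(1) by auto
      moreover have "\<bar>v\<bar> = k \<or> \<bar>v\<bar> = 2 * k" using v(1) k(1) by linarith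
      then have "h v = k" using k unfolding h_def by auto
      ultimately show "k \<in> h ` ?M" by blast
    qed
    then have "card {int w + 1..2 * int w + 1} \<le> card ?M"
      by (intro surj_card_le) simp_all
    then show False using missing by simp
  qed
  then obtain k where k: "k \<in> {int w + 1..2 * int w + 1}"
    and kK: "k \<in> K" "- k \<in> K" "- 2 * k \<in> K" "2 * k \<in> K" by auto
  have k0: "int w < k" "k \<le> 2 * int w + 1" using k by auto
  have big': "(d + 4 * int w + 1) < E" using big by simp
  have "\<exists>a\<ge>k. a \<in> K \<and> a + 1 \<in> K \<and> fst (x (a + 1)) = fst (x a) \<and>
      snd (x (a + 1)) = snd (x a) - 1 \<and> d \<le> snd (x (a + 1))"
    using missing d by (intro descending_pair[OF _ k0 kK(1-3) E big']) auto
  then obtain a where a: "k \<le> a" "a \<in> K" "a + 1 \<in> K" "fst (x (a + 1)) = fst (x a)"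
    "snd (x (a + 1)) = snd (x a) - 1" "d \<le> snd (x (a + 1))" by blast
  \<comment> \<open>The reflected grid yields the second unit step; there \<open>2 * k\<close> plays
    the part of \<open>- 2 * k\<close>, so all four diagonals are required in
    \<open>K\<close>.\<close>
  interpret T: diagonal_representatives n m "c \<circ> prod.swap" "uminus ` K" "\<lambda>k. prod.swap (x (- k))"
    by (rule transposed)
  have um: "v \<in> uminus ` K \<longleftrightarrow> - v \<in> K" for v by force
  have "{1 - m..n - 1} - {0} - uminus ` K = uminus ` ?M"
  proof (intro set_eqI)
    fix v
    have "v \<in> uminus ` ?M \<longleftrightarrow> - v \<in> ?M" by force
    then show "v \<in> {1 - m..n - 1} - {0} - uminus ` K \<longleftrightarrow> v \<in> uminus ` ?M" by (auto simp: um)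
  qed
  then have "card ({1 - m..n - 1} - {0} - uminus ` K) \<le> w"
    using missing by (simp add: card_image)
  then have "\<exists>b\<ge>k. b \<in> uminus ` K \<and> b + 1 \<in> uminus ` K \<and>
      fst (prod.swap (x (- (b + 1)))) = fst (prod.swap (x (- b))) \<and>
      snd (prod.swap (x (- (b + 1)))) = snd (prod.swap (x (- b))) - 1 \<and>
      d \<le> snd (prod.swap (x (- (b + 1))))"
    using d kK by (intro T.descending_pair[OF _ k0 _ _ _ E(2,1) _ big']) (auto simp: um E(3))
  then obtain b where b: "k \<le> b" "- b \<in> K" "- (b + 1) \<in> K"
    "snd (x (- (b + 1))) = snd (x (- b))"
    "fst (x (- (b + 1))) = fst (x (- b)) - 1" "d \<le> fst (x (- (b + 1)))"
    unfolding um fst_swap snd_swap by blast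

  have low_old: "c (i, j) \<in> old" if "l \<in> K" "(i, j) \<in> grid m n" "i - j = l" "i < fst (x l)" for i j l
    using x_low[OF that(1-3)] that(4) by force
  have dold: "c (d - 1, d - 1) \<in> old" "c (d, d) \<in> old"
    using d E big by (auto intro!: oldI)

  define i j where "i = fst (x (- b))" and "j = snd (x (- b))"
  then have x1: "x (- b) = (i, j)" "x (- (b + 1)) = (i - 1, j)" "i - j = - b" "d \<le> i - 1"
    using x_diag[OF b(2)] b(4-6) by (auto simp: prod_eq_iff)
  have x1g: "(i, j) \<in> grid m n" "(i - 1, j) \<in> grid m n"
    using x_grid[OF b(2)] x_grid[OF b(3)] unfolding x1(1,2) by auto
  have b0: "0 < b" using b(1) k0 by simp
  \<comment> \<open>This cell is both \<open>x (- (b + 1)) - (d - 1, d - 1)\<close> and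
    \<open>x (- b) - (d, d - 1)\<close>, so it links the colours of \<open>(d - 1, d - 1)\<close>
    and \<open>(d, d - 1)\<close>. It is old because \<open>d \<ge> 2\<close> puts it below
    \<open>x (- (b + 1))\<close>.\<close>
  have v1: "c (i - d, j - (d - 1)) \<in> old"
    using x1 x1g d b0 by (intro low_old[OF b(3)]) (auto simp: grid_def)
  have "c (d - 1, d - 1) = c (i - 1 - (d - 1), j - (d - 1)) \<or> c (d - 1, d - 1) = c (i - 1, j)
      \<or> c (i - 1 - (d - 1), j - (d - 1)) = c (i - 1, j)"
    using x1 x1g d b0 E big by (intro free_diff) (auto simp: grid_def)
  then have s1: "c (d - 1, d - 1) = c (i - d, j - (d - 1))"
    using x_new[OF b(3)] x1(2) v1 dold by auto
  have ug: "(d, d - 1) \<in> grid m n" using d E big by (auto simp: grid_def)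
  have "c (d, d - 1) = c (i - d, j - (d - 1)) \<or> c (d, d - 1) = c (i, j)
      \<or> c (i - d, j - (d - 1)) = c (i, j)"
    using x1 x1g d b0 by (intro free_diff[OF ug]) auto
  \<comment> \<open>By \<open>x_near\<close> the colour of \<open>x (- b)\<close> can reach diagonal
    \<open>1\<close> only if \<open>b = k = 1\<close>; but then that diagonal is in \<open>K\<close>
    and has a new colour of its own.\<close>
  moreover have "c (d, d - 1) \<noteq> c (i, j)"
  proof
    assume eq: "c (d, d - 1) = c (i, j)"
    then have "\<bar>- b\<bar> \<le> \<bar>d - (d - 1)\<bar>" using x1(1) by (intro x_near[OF b(2) ug]) simp
    then have "b = 1" "k = 1" using b0 b(1) k0 by auto
    then show False using other_new_on_diag[OF kK(1) b(2) ug] eq x1 by simp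
  qed
  ultimately have s2: "c (d, d - 1) = c (d - 1, d - 1)"
    using x_new[OF b(2)] x1(1) v1 s1 by auto

  define i' j' where "i' = fst (x a)" and "j' = snd (x a)"
  then have x2: "x a = (i', j')" "x (a + 1) = (i', j' - 1)" "i' - j' = a" "d \<le> j' - 1"
    using x_diag[OF a(2)] a(4-6) by (auto simp: prod_eq_iff)
  have x2g: "(i', j') \<in> grid m n" "(i', j' - 1) \<in> grid m n"
    using x_grid[OF a(2)] x_grid[OF a(3)] unfolding x2(1,2) by auto
  have a0: "0 < a" using a(1) k0 by simp
  \<comment> \<open>This cell is both \<open>x a - (d, d)\<close> and
    \<open>x (a + 1) - (d, d - 1)\<close>, so it links \<open>(d, d)\<close> to
    \<open>(d, d - 1)\<close>.\<close>
  have v2: "c (i' - d, j' - d) \<in> old"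
    using x2 x2g d a0 by (intro low_old[OF a(2)]) (auto simp: grid_def)
  have "c (d, d) = c (i' - d, j' - d) \<or> c (d, d) = c (i', j') \<or> c (i' - d, j' - d) = c (i', j')"
    using x2 x2g d a0 E big by (intro free_diff) (auto simp: grid_def)
  then have s3: "c (d, d) = c (i' - d, j' - d)"
    using x_new[OF a(2)] x2(1) v2 dold by auto
  have "c (d, d - 1) = c (i' - d, j' - 1 - (d - 1)) \<or> c (d, d - 1) = c (i', j' - 1)
      \<or> c (i' - d, j' - 1 - (d - 1)) = c (i', j' - 1)"
    using x2 x2g d a0 by (intro free_diff[OF ug]) auto
  then have "c (d, d - 1) = c (d, d)"
    using x_new[OF a(3)] x2(2) v2 s2 s3 dold by auto
  then show False using s2 d by simp
qed

end

section \<open>Counting the colours\<close>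

lemma finite_grid: "finite (grid m n)"
  by (rule finite_subset[of _ "{1..m} \<times> {1..n}"]) (auto simp: grid_def)

context rainbow_free_grid
begin

text \<open>Each new colour is assigned a nearest diagonal carrying it. A diagonal has at most one
  new colour, so the assignment is injective and the lowest new cell of that diagonal has the
  assigned colour.\<close>

lemma representatives_exist:
  obtains K x where "diagonal_representatives m n c K x"
    "K \<subseteq> {1 - n..m - 1} - {0}" "card K = card (c ` grid m n - old)"
proof -
  define N where "N = c ` grid m n - old"
  have "\<exists>y. y \<in> grid m n \<and> c y = col \<and>
      (\<forall>y'. y' \<in> grid m n \<and> c y' = col \<longrightarrow> nat \<bar>fst y - snd y\<bar> \<le> nat \<bar>fst y' - snd y'\<bar>)"
    if col: "col \<in> N" for col
  proof -
    obtain y where "y \<in> grid m n \<and> c y = col" using col unfolding N_def by blast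
    then show ?thesis
      using ex_has_least_nat[of "\<lambda>y. y \<in> grid m n \<and> c y = col" y "\<lambda>y. nat \<bar>fst y - snd y\<bar>"]
      by blast
  qed
  then obtain z where z: "\<And>col. col \<in> N \<Longrightarrow> z col \<in> grid m n" "\<And>col. col \<in> N \<Longrightarrow> c (z col) = col"
    and near: "\<And>col y. col \<in> N \<Longrightarrow> y \<in> grid m n \<Longrightarrow> c y = col \<Longrightarrow>
      nat \<bar>fst (z col) - snd (z col)\<bar> \<le> nat \<bar>fst y - snd y\<bar>"
    by metis
  define \<kappa> where "\<kappa> col = fst (z col) - snd (z col)" for col
  define K where "K = \<kappa> ` N"
  define P where "P k y \<longleftrightarrow> y \<in> grid m n \<and> fst y - snd y = k \<and> c y \<notin> old" for k y
  have "\<exists>y. P k y \<and> (\<forall>y'. P k y' \<longrightarrow> nat (fst y) \<le> nat (fst y'))" if k: "k \<in> K" for k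
  proof -
    obtain col where "col \<in> N" "k = \<kappa> col" using k unfolding K_def by auto
    then have "P k (z col)" using z[of col] unfolding P_def \<kappa>_def N_def by auto
    then show ?thesis using ex_has_least_nat[of "P k" "z col" "\<lambda>y. nat (fst y)"] by blast
  qed
  then obtain x where x: "\<And>k. k \<in> K \<Longrightarrow> P k (x k)"
    and low: "\<And>k y. k \<in> K \<Longrightarrow> P k y \<Longrightarrow> nat (fst (x k)) \<le> nat (fst y)"
    by metis
  have cx: "c (x (\<kappa> col)) = col" if col: "col \<in> N" for col
  proof -
    have "P (\<kappa> col) (x (\<kappa> col))" using x col unfolding K_def by blast
    moreover have "P (\<kappa> col) (z col)" using z[OF col] col unfolding P_def \<kappa>_def N_def by auto
    ultimately have "c (x (\<kappa> col)) = c (z col)"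
      using new_unique[of "fst (x (\<kappa> col))" "snd (x (\<kappa> col))" "fst (z col)" "snd (z col)"]
      unfolding P_def by simp
    then show ?thesis using z(2)[OF col] by simp
  qed
  have K0: "0 \<notin> K"
  proof
    assume "0 \<in> K"
    then have "P 0 (x 0)" by (rule x)
    then show False unfolding P_def by (cases "x 0") (auto simp: grid_def oldI)
  qed
  have "diagonal_representatives m n c K x"
  proof
    show "0 \<notin> K" by (rule K0)
    fix k assume k: "k \<in> K"
    then obtain col where col: "col \<in> N" "k = \<kappa> col" unfolding K_def by auto
    show "x k \<in> grid m n" "fst (x k) - snd (x k) = k" "c (x k) \<notin> old"
      using x[OF k] unfolding P_def by auto
    show "fst (x k) \<le> i" if "(i, j) \<in> grid m n" "i - j = k" "c (i, j) \<notin> old" for i j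
      using low[OF k, of "(i, j)"] that unfolding P_def by (auto simp: grid_def nat_le_iff)
    show "k = l" if "l \<in> K" "c (x k) = c (x l)" for l
      using that cx col unfolding K_def by auto
    show "\<bar>k\<bar> \<le> \<bar>i - j\<bar>" if "(i, j) \<in> grid m n" "c (i, j) = c (x k)" for i j
      using near[OF col(1) that(1)] that(2) cx[OF col(1)] col(2) unfolding \<kappa>_def by simp
  qed
  moreover have "K \<subseteq> {1 - n..m - 1} - {0}"
  proof
    fix k assume k: "k \<in> K"
    then have "k \<noteq> 0" using K0 by auto
    then show "k \<in> {1 - n..m - 1} - {0}"
      using x[OF k] unfolding P_def by (cases "x k") (auto simp: grid_def)
  qed
  moreover have "inj_on \<kappa> N" using cx by (metis inj_onI)
  then have "card K = card (c ` grid m n - old)"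
    unfolding K_def N_def by (rule card_image)
  ultimately show thesis by (rule that)
qed

lemma card_colours_le:
  assumes "1 \<le> m" "1 \<le> n"
  shows "int (card (c ` grid m n)) \<le> m + n"
proof (rule ccontr)
  assume many: "\<not> int (card (c ` grid m n)) \<le> m + n"
  obtain K x where D: "diagonal_representatives m n c K x"
    and K: "K \<subseteq> {1 - n..m - 1} - {0}" and cardK: "card K = card (c ` grid m n - old)"
    by (rule representatives_exist)
  have "old \<subseteq> c ` grid m n" unfolding old_def by (auto simp: grid_def)
  then have "card (c ` grid m n) = card old + card K"
    using finite_grid[of m n] by (simp add: cardK card_Diff_subset card_mono finite_subset[of old])
  moreover have "int (card ({1 - n..m - 1} - {0})) = m + n - 2"
    using assms by (simp add: card_Diff_subset)
  moreover have "finite K" using K by (rule finite_subset) simp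
  then have "card ({1 - n..m - 1} - {0} - K) = card ({1 - n..m - 1} - {0}) - card K"
    using K by (rule card_Diff_subset)
  moreover have "card K \<le> card ({1 - n..m - 1} - {0})" using K by (intro card_mono) auto
  \<comment> \<open>More than \<open>m + n\<close> colours give
    \<open>card old + card K \<ge> m + n + 1\<close>. As \<open>card K \<le> m + n - 2\<close>,
    \<open>card old \<ge> 3\<close> and the subtraction is not truncated.\<close>
  ultimately have "card ({1 - n..m - 1} - {0} - K) \<le> card old - 3" "card old = (card old - 3) + 3"
    using many by linarith+
  then show False by (rule diagonal_representatives.too_few_missing[OF D])
qed

end

section \<open>Colourings for the lower bound\<close>

lemma exact_coloring_card:
  assumes "exact_coloring r S c"
  shows "card (c ` S) = r"
proof -
  have "c ` S \<subseteq> {1..r}" using assms unfolding exact_coloring_def coloring_def by blast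
  moreover have "k \<in> c ` S" if "k \<in> {1..r}" for k
    using assms that unfolding exact_coloring_def by (metis imageI)
  ultimately have "c ` S = {1..r}" by blast
  then show ?thesis by simp
qed

text \<open>The cells of the last row and column are never summands, so giving each of them its
  own colour creates no rainbow solution; \<open>min r\<close> merges colours.\<close>

lemma rainbow_free_exact_coloring:
  fixes m n :: int and r :: nat
  assumes "2 \<le> m" "2 \<le> n" "1 \<le> r" "int r \<le> m + n"
  obtains c where "exact_coloring r (grid m n) c"
    "\<And>\<alpha> \<beta> \<gamma>. solution (grid m n) \<alpha> \<beta> \<gamma> \<Longrightarrow> \<not> rainbow c \<alpha> \<beta> \<gamma>"
proof
  \<comment> \<open>The cells with \<open>j = n\<close> get \<open>1..m\<close>, the others with
    \<open>i = m\<close> get \<open>m + 1..m + n - 1\<close>, and all remaining cells, among them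
    \<open>(1, 1)\<close> and every summand, share \<open>m + n\<close>.\<close>
  define b where "b = (\<lambda>(i, j). if j = n then i else if i = m then m + j else m + n)"
  define c where "c = (\<lambda>y. min r (nat (b y)))"
  have "\<exists>y\<in>grid m n. c y = k" if k: "k \<in> {1..r}" for k
  proof -
    have "int k \<le> m + n" using k assms by auto
    then consider "int k \<le> m" | "m < int k" "int k < m + n" | "int k = m + n" by linarith
    then obtain y where "y \<in> grid m n" "b y = int k"
    proof cases
      case 1
      then show ?thesis using that[of "(int k, n)"] k assms by (auto simp: grid_def b_def)
    next
      case 2
      then show ?thesis using that[of "(m, int k - m)"] k assms by (auto simp: grid_def b_def)
    next
      case 3
      then show ?thesis using that[of "(1, 1)"] k assms by (auto simp: grid_def b_def)
    qed
    then show ?thesis using k unfolding c_def by (intro bexI[of _ y]) auto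
  qed
  moreover have "c y \<in> {1..r}" if "y \<in> grid m n" for y
    using that assms by (cases y) (auto simp: c_def b_def grid_def)
  ultimately show "exact_coloring r (grid m n) c"
    unfolding exact_coloring_def coloring_def by blast
  show "\<not> rainbow c \<alpha> \<beta> \<gamma>" if "solution (grid m n) \<alpha> \<beta> \<gamma>" for \<alpha> \<beta> \<gamma>
  proof -
    have "b \<alpha> = m + n" "b \<beta> = m + n"
      using that by (auto simp: solution_def grid_def b_def split: prod.splits)
    then show ?thesis by (simp add: rainbow_def c_def)
  qed
qed

section \<open>The value of the rainbow number\<close>

theorem theorem5p5:
  fixes m n :: int
  assumes "2 \<le> m" and "m \<le> n"
  shows "int (rainbow_number (grid m n)) = m + n + 1"
proof -
  have "rainbow_number (grid m n) = nat (m + n + 1)"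
    unfolding rainbow_number_def
  proof (rule Least_equality)
    have "\<exists>\<alpha> \<beta> \<gamma>. solution (grid m n) \<alpha> \<beta> \<gamma> \<and> rainbow c \<alpha> \<beta> \<gamma>"
      if c: "exact_coloring (nat (m + n + 1)) (grid m n) c" for c
    proof (rule ccontr)
      assume no: "\<not> ?thesis"
      interpret rainbow_free_grid m n c
      proof
        fix \<alpha> \<beta> assume "\<alpha> \<in> grid m n" "\<beta> \<in> grid m n" "\<alpha> + \<beta> \<in> grid m n"
        then have "solution (grid m n) \<alpha> \<beta> (\<alpha> + \<beta>)" by (simp add: solution_def)
        then have "\<not> rainbow c \<alpha> \<beta> (\<alpha> + \<beta>)" using no by blast
        then show "c \<alpha> = c \<beta> \<or> c \<alpha> = c (\<alpha> + \<beta>) \<or> c \<beta> = c (\<alpha> + \<beta>)"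
          unfolding rainbow_def by blast
      qed
      have "int (card (c ` grid m n)) \<le> m + n" using assms by (intro card_colours_le) auto
      then show False using exact_coloring_card[OF c] assms by simp
    qed
    moreover have "1 \<le> nat (m + n + 1)" using assms by simp
    ultimately show "1 \<le> nat (m + n + 1) \<and> (\<forall>c. exact_coloring (nat (m + n + 1)) (grid m n) c \<longrightarrow>
        (\<exists>\<alpha> \<beta> \<gamma>. solution (grid m n) \<alpha> \<beta> \<gamma> \<and> rainbow c \<alpha> \<beta> \<gamma>))"
      by blast
  next
    fix r :: nat
    assume r: "1 \<le> r \<and> (\<forall>c. exact_coloring r (grid m n) c \<longrightarrow>
        (\<exists>\<alpha> \<beta> \<gamma>. solution (grid m n) \<alpha> \<beta> \<gamma> \<and> rainbow c \<alpha> \<beta> \<gamma>))"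
    show "nat (m + n + 1) \<le> r"
    proof (rule ccontr)
      assume "\<not> nat (m + n + 1) \<le> r"
      then have "int r \<le> m + n" by linarith
      moreover have "2 \<le> n" using assms by simp
      ultimately obtain c where "exact_coloring r (grid m n) c"
        "\<And>\<alpha> \<beta> \<gamma>. solution (grid m n) \<alpha> \<beta> \<gamma> \<Longrightarrow> \<not> rainbow c \<alpha> \<beta> \<gamma>"
        using rainbow_free_exact_coloring[of m n r] assms(1) r by blast
      then show False using r by blast
    qed
  qed
  then show ?thesis using assms by simp
qed

end
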